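(* Let $P_\infty:=[0,2\pi)\times\mathbb{R}$ and $$\mathbf{v}(t,r):=\big(\cos t+r\cos\tfrac t2\,\cos t,\ \sin t+r\cos\tfrac t2\,\sin t,\ r\sin\tfrac t2\big)\in\mathbb{R}^3\quad\text{for }(t,r)\in P_\infty.$$ For $(x,y)\in\mathbb{R}^2$ let $Z_{\mathbf{v}}(x,y):=\{z\in\mathbb{R}\colon(x,y,z)\in\mathbf{v}(P_\infty)\}$ and $n_{\mathbf{v}}(x,y):=\operatorname{card}Z_{\mathbf{v}}(x,y)$. Then for any $(x,y)\in\mathbb{R}^2$, $$n_{\mathbf{v}}(x,y)=\begin{cases}2&\text{if }x\ne-1\text{ and }y\ne0,\\ 1&\text{if }x=-1\text{ and }y\ne0,\\ 1&\text{if }x\notin\{-1,0\}\text{ and }y=0,\\ \infty&\text{if }x\in\{-1,0\}\text{ and }y=0.\end{cases}$$ Moreover, $Z_{\mathbf{v}}(-1,0)=Z_{\mathbf{v}}(0,0)=\mathbb{R}$.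
   Context: For a set $S$, $\operatorname{card}S$ denotes the number of elements of $S$ if $S$ is finite, and $\operatorname{card}S=\infty$ otherwise. *)

theory Defs
  imports Complex_Main "HOL-Library.Extended_Nat"
begin

(* Cardinality valued in the extended naturals; the library's card is 0 on infinite sets. *)
definition ecard :: "'a set \<Rightarrow> enat" where
  "ecard S = (if finite S then enat (card S) else \<infinity>)"

definition P_inf :: "(real \<times> real) set" where
  "P_inf = {0..<2 * pi} \<times> UNIV"

definition moebius :: "real \<times> real \<Rightarrow> real \<times> real \<times> real" where
  "moebius = (\<lambda>(t, r).
     (cos t + r * cos (t / 2) * cos t,
      sin t + r * cos (t / 2) * sin t,
      r * sin (t / 2)))"

definition Z_v :: "real \<Rightarrow> real \<Rightarrow> real set" where
  "Z_v x y = {z. (x, y, z) \<in> moebius ` P_inf}"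

definition n_v :: "real \<Rightarrow> real \<Rightarrow> enat" where
  "n_v x y = ecard (Z_v x y)"

end

theory Submission
  imports Defs
begin

text \<open>
  With \<open>w = 1 + r cos (t/2)\<close> the horizontal part of the surface is \<open>w (cos t, sin t)\<close>, so over
  \<open>(x, y)\<close> with \<open>y \<noteq> 0\<close> there are exactly the two choices \<open>w = \<plusminus> sqrt (x\<^sup>2 + y\<^sup>2)\<close>, and
  \<open>z = (w - 1) tan (t/2)\<close> with \<open>tan (t/2) = sin t / (1 + cos t) = y / (w + x)\<close>. The two values
  of \<open>z\<close> coincide iff \<open>x = -1\<close>. Over \<open>y = 0\<close> either \<open>t = 0\<close>, giving \<open>z = 0\<close>, or
  \<open>t = \<pi>\<close>, a vertical line over \<open>(-1, 0)\<close>, or \<open>w = 0\<close>, where \<open>z = - tan (t/2)\<close> is arbitrary.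
\<close>

lemma mem_Z_v_iff:
  "z \<in> Z_v x y \<longleftrightarrow> (\<exists>t r. 0 \<le> t \<and> t < 2 * pi \<and> x = (1 + r * cos (t / 2)) * cos t \<and>
     y = (1 + r * cos (t / 2)) * sin t \<and> z = r * sin (t / 2))"
  unfolding Z_v_def moebius_def P_inf_def image_iff Bex_def
  by (auto simp: algebra_simps)

lemma sin_double_half: "sin t = 2 * sin (t / 2) * cos (t / 2)" for t :: real
  using sin_double[of "t / 2"] by simp

lemma cos_double_half: "cos t = 2 * (cos (t / 2))\<^sup>2 - 1" for t :: real
  using cos_double_cos[of "t / 2"] by simp

text \<open>Keeps the denominator \<open>w + x\<close> nonzero for either sign of the root
  \<open>w\<close>: \<open>w = - x\<close> would force \<open>y\<^sup>2 = 0\<close>.\<close>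

lemma add_root_sum_squares_nonzero:
  fixes w x y :: real
  assumes "w\<^sup>2 = x\<^sup>2 + y\<^sup>2" "y \<noteq> 0"
  shows "w + x \<noteq> 0"
proof
  assume "w + x = 0"
  then have "w = - x" by simp
  with assms show False by simp
qed

text \<open>Trades the pair \<open>(t, r)\<close> for the signed distance \<open>w\<close> from the
  vertical axis; \<open>w\<close> determines \<open>t\<close> as a polar angle, and then
  \<open>r\<close>.\<close>

lemma mem_Z_v_off_axis:
  assumes y: "y \<noteq> 0"
  shows "z \<in> Z_v x y \<longleftrightarrow> (\<exists>w. w\<^sup>2 = x\<^sup>2 + y\<^sup>2 \<and> z = (w - 1) * y / (w + x))"
proof
  assume "z \<in> Z_v x y"
  then obtain t r where x_eq: "x = (1 + r * cos (t / 2)) * cos t"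
    and y_eq: "y = (1 + r * cos (t / 2)) * sin t" and z: "z = r * sin (t / 2)"
    unfolding mem_Z_v_iff by blast
  define w where "w = 1 + r * cos (t / 2)"
  have w: "w\<^sup>2 = x\<^sup>2 + y\<^sup>2"
    unfolding x_eq y_eq w_def[symmetric] power_mult_distrib distrib_left[symmetric] by simp
  have "w + x = 2 * w * (cos (t / 2))\<^sup>2"
    unfolding x_eq w_def[symmetric] cos_double_half[of t] by (simp add: algebra_simps)
  moreover have "y = 2 * w * sin (t / 2) * cos (t / 2)"
    unfolding y_eq w_def[symmetric] sin_double_half[of t] by simp
  moreover have "w - 1 = r * cos (t / 2)" by (simp add: w_def)
  \<comment> \<open>Both sides equal
    \<open>2 * w * r * sin (t / 2) * (cos (t / 2))\<^sup>2\<close>.\<close>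
  ultimately have "z * (w + x) = (w - 1) * y"
    unfolding z by (simp add: power2_eq_square)
  then have "z = (w - 1) * y / (w + x)"
    using add_root_sum_squares_nonzero[OF w y] by (simp add: eq_divide_eq)
  with w show "\<exists>w. w\<^sup>2 = x\<^sup>2 + y\<^sup>2 \<and> z = (w - 1) * y / (w + x)" by blast
next
  assume "\<exists>w. w\<^sup>2 = x\<^sup>2 + y\<^sup>2 \<and> z = (w - 1) * y / (w + x)"
  then obtain w where w: "w\<^sup>2 = x\<^sup>2 + y\<^sup>2" and z: "z = (w - 1) * y / (w + x)" by blast
  have "w \<noteq> 0" using w y by (auto simp: sum_power2_eq_zero_iff)
  \<comment> \<open>Dividing by the signed \<open>w\<close> makes the two roots yield opposite
    points of the unit circle.\<close>
  have "(x / w)\<^sup>2 + (y / w)\<^sup>2 = 1"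
    using w y \<open>w \<noteq> 0\<close> by (simp add: power_divide add_divide_distrib[symmetric])
  then obtain t where t: "0 \<le> t" "t < 2 * pi" "x / w = cos t" "y / w = sin t"
    using sincos_total_2pi by blast
  have x_eq: "x = w * cos t" and y_eq: "y = w * sin t"
    using t \<open>w \<noteq> 0\<close> by (simp_all add: field_simps)
  have c: "cos (t / 2) \<noteq> 0"
    using y y_eq sin_double_half[of t] by auto
  \<comment> \<open>Solves \<open>1 + r * cos (t / 2) = w\<close>.\<close>
  define r where "r = (w - 1) / cos (t / 2)"
  have rc: "r * cos (t / 2) = w - 1" using c by (simp add: r_def)
  have wx: "w + x = 2 * w * (cos (t / 2))\<^sup>2"
    unfolding x_eq cos_double_half[of t] by (simp add: algebra_simps)
  have "z = r * sin (t / 2)"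
    unfolding z wx unfolding y_eq sin_double_half[of t] r_def using c \<open>w \<noteq> 0\<close>
    by (simp add: power2_eq_square)
  then show "z \<in> Z_v x y"
    unfolding mem_Z_v_iff using t x_eq y_eq rc by (intro exI[of _ t] exI[of _ r]) simp
qed

lemma Z_v_off_axis:
  fixes x y :: real
  assumes "y \<noteq> 0"
  defines "\<rho> \<equiv> sqrt (x\<^sup>2 + y\<^sup>2)"
  shows "Z_v x y = {(\<rho> - 1) * y / (\<rho> + x), (- \<rho> - 1) * y / (- \<rho> + x)}"
proof -
  have "w\<^sup>2 = x\<^sup>2 + y\<^sup>2 \<longleftrightarrow> w = \<rho> \<or> w = - \<rho>" for w
    by (metis \<rho>_def power2_eq_iff real_sqrt_pow2 sum_power2_ge_zero)
  then show ?thesis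
    by (simp add: set_eq_iff mem_Z_v_off_axis[OF assms(1)] ex_disj_distrib conj_disj_distribR)
qed

text \<open>After cross-multiplication the two sides differ by
  \<open>2 * y * \<rho> * (x + 1)\<close>, and \<open>\<rho>\<close> is nonzero because
  \<open>y\<close> is.\<close>

lemma Z_v_off_axis_coincide_iff:
  fixes x y \<rho> :: real
  assumes y: "y \<noteq> 0" and \<rho>: "\<rho>\<^sup>2 = x\<^sup>2 + y\<^sup>2"
  shows "(\<rho> - 1) * y / (\<rho> + x) = (- \<rho> - 1) * y / (- \<rho> + x) \<longleftrightarrow> x = - 1"
proof -
  have "\<rho> \<noteq> 0" using \<rho> y by (auto simp: sum_power2_eq_zero_iff)
  have nz: "\<rho> + x \<noteq> 0" "- \<rho> + x \<noteq> 0"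
    using add_root_sum_squares_nonzero[of \<rho> x y] add_root_sum_squares_nonzero[of "- \<rho>" x y] \<rho> y
    by auto
  have "(\<rho> - 1) * y / (\<rho> + x) = (- \<rho> - 1) * y / (- \<rho> + x) \<longleftrightarrow>
        (\<rho> - 1) * y * (- \<rho> + x) = (- \<rho> - 1) * y * (\<rho> + x)"
    using nz by (rule frac_eq_eq)
  also have "\<dots> \<longleftrightarrow> 2 * y * \<rho> * (x + 1) = 0"
    by (auto simp: algebra_simps)
  also have "\<dots> \<longleftrightarrow> x = - 1"
    using y \<open>\<rho> \<noteq> 0\<close> by auto
  finally show ?thesis .
qed

lemma mem_Z_v_axis:
  "z \<in> Z_v x 0 \<longleftrightarrow> z = 0 \<or> x = - 1 \<or> x = 0"
proof
  assume "z \<in> Z_v x 0"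
  then obtain t r where t: "0 \<le> t" "t < 2 * pi" and x: "x = (1 + r * cos (t / 2)) * cos t"
    and y: "0 = (1 + r * cos (t / 2)) * sin t" and z: "z = r * sin (t / 2)"
    unfolding mem_Z_v_iff by blast
  \<comment> \<open>The cases give \<open>x = 0\<close>, \<open>z = 0\<close> and
    \<open>x = - 1\<close>, in this order; in the last one \<open>cos t = - 1\<close> and the radial
    factor is 1.\<close>
  from y consider "1 + r * cos (t / 2) = 0" | "sin (t / 2) = 0" | "cos (t / 2) = 0"
    using sin_double_half[of t] by auto
  then show "z = 0 \<or> x = - 1 \<or> x = 0"
    by cases (use x z cos_double_half[of t] in auto)
next
  assume "z = 0 \<or> x = - 1 \<or> x = 0"
  then consider "z = 0" | "x = - 1" | "x = 0" "z \<noteq> 0" by blast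
  then show "z \<in> Z_v x 0"
  proof cases
    case 1
    then show ?thesis
      unfolding mem_Z_v_iff by (intro exI[of _ 0] exI[of _ "x - 1"]) simp
  next
    case 2
    then show ?thesis
      unfolding mem_Z_v_iff by (intro exI[of _ pi] exI[of _ z]) simp
  next
    case 3
    \<comment> \<open>A zero radial factor means \<open>z = - tan (t / 2)\<close>. With
      \<open>t = pi + 2 * u\<close> this reads \<open>z = cot u\<close>, and the range of
      \<open>arctan\<close> puts \<open>t\<close> strictly between 0 and \<open>2 * pi\<close>.
      Since \<open>cos (t / 2) = - sin u\<close>, the factor vanishes for
      \<open>r = 1 / sin u\<close>.\<close>
    define u where "u = arctan (1 / z)"
    have u: "- (pi / 2) < u" "u < pi / 2" "tan u = 1 / z"
      unfolding u_def using arctan_bounded[of "1 / z"] tan_arctan by blast+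
    have "sin u \<noteq> 0" using u(3) \<open>z \<noteq> 0\<close> by (auto simp: tan_def)
    have "z = cos u / sin u"
      using u(3) \<open>z \<noteq> 0\<close> \<open>sin u \<noteq> 0\<close> by (auto simp: tan_def field_simps)
    moreover have "cos ((pi + 2 * u) / 2) = - sin u" "sin ((pi + 2 * u) / 2) = cos u"
      by (simp_all add: add_divide_distrib cos_add sin_add)
    ultimately show ?thesis
      unfolding mem_Z_v_iff using u 3 \<open>sin u \<noteq> 0\<close>
      by (intro exI[of _ "pi + 2 * u"] exI[of _ "1 / sin u"]) simp
  qed
qed

theorem proposition1p8:
  shows "(\<forall>x y :: real.
           (x \<noteq> -1 \<and> y \<noteq> 0 \<longrightarrow> n_v x y = 2) \<and>
           (x = -1 \<and> y \<noteq> 0 \<longrightarrow> n_v x y = 1) \<and>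
           (x \<notin> {-1, 0} \<and> y = 0 \<longrightarrow> n_v x y = 1) \<and>
           (x \<in> {-1, 0} \<and> y = 0 \<longrightarrow> n_v x y = \<infinity>)) \<and>
         Z_v (-1) 0 = (UNIV :: real set) \<and>
         Z_v 0 0 = (UNIV :: real set)"
proof -
  have off_axis: "n_v x y = (if x = - 1 then 1 else 2)" if "y \<noteq> 0" for x y
  proof -
    let ?\<rho> = "sqrt (x\<^sup>2 + y\<^sup>2)"
    have "?\<rho>\<^sup>2 = x\<^sup>2 + y\<^sup>2" by simp
    \<comment> \<open>The fibre is written with two entries, so its size is 1 or 2 according to
      whether they coincide.\<close>
    from Z_v_off_axis_coincide_iff[OF that this] show ?thesis
      unfolding n_v_def ecard_def Z_v_off_axis[OF that]
      by (simp add: card_insert_if one_enat_def numeral_eq_enat)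
  qed
  have UNIV: "Z_v x 0 = UNIV" if "x \<in> {- 1, 0}" for x
    using that by (auto simp: mem_Z_v_axis)
  moreover have "Z_v x 0 = {0}" if "x \<notin> {- 1, 0}" for x
    using that by (auto simp: mem_Z_v_axis)
  ultimately show ?thesis
    using off_axis by (auto simp: n_v_def ecard_def one_enat_def infinite_UNIV_char_0)
qed

end
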